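(* Let $n\ge2$ and suppose all detection rates are equal: $\lambda_i=\lambda>0$ for all $i\in\{1,\dots,n\}$. Then the best simple cycle searches every location for the same amount of time: if $\mathbf x^*=(x_1^*,\dots,x_n^* )\in(0,\infty)^n$ minimizes $\max_{i}f_i(\mathbf x)$ over all $\mathbf x\in(0,\infty)^n$, then $x_1^*=x_2^*=\cdots=x_n^*$.
   Context: A simple cycle along a minimum Hamiltonian cycle with total travel time $D_{\min}>0$ is given by $\mathbf x=(x_1,\dots,x_n)\in(0,\infty)^n$, where $x_i$ is the time spent searching location $i$ once per cycle; the cycle is repeated forever. Its length is $c(\mathbf x)=\sum_{j=1}^nx_j+D_{\min}$. The expected time to detect an attacker at location $i$ (arriving at a time uniform on a cycle, and detected at rate $\lambda_i$ exactly while the patroller searches location $i$) is $$ f_i(\mathbf x)=\frac1{\lambda_i}+\frac{c(\mathbf x)-x_i}{c(\mathbf x)}\left(\frac1{\lambda_i}-\frac{c(\mathbf x)-x_i}{2}+\frac{c(\mathbf x)-x_i}{1-e^{-\lambda_i x_i}}\right). $$ *)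

theory Defs
  imports "HOL-Analysis.Analysis"
begin

text \<open>
  Locations are indexed by a finite type \<open>'n\<close>, so the number of locations is \<open>CARD('n)\<close>.
  A simple cycle is represented by its search times \<open>x :: real ^ 'n\<close>; the travel part of the
  cycle enters only through its total travel time \<open>D\<close>. The detection rate at location \<open>i\<close>
  is \<open>lam i\<close>.
\<close>

definition simple_cycles :: "(real ^ 'n) set" where
  "simple_cycles = {x. \<forall>i. 0 < x $ i}"

definition cycle_length :: "real \<Rightarrow> real ^ 'n \<Rightarrow> real" where
  "cycle_length D x = (\<Sum>j\<in>UNIV. x $ j) + D"

text \<open>
  Closed form of the expected detection time at \<open>i\<close> for an arrival uniform on the cycle, with
  detection at rate \<open>lam i\<close> exactly while \<open>i\<close> is being searched. The denominators are
  nonzero for \<open>0 < D\<close>, \<open>0 < lam i\<close> and \<open>x \<in> simple_cycles\<close>.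
\<close>

definition expected_detection_time ::
    "real \<Rightarrow> ('n \<Rightarrow> real) \<Rightarrow> 'n \<Rightarrow> real ^ 'n \<Rightarrow> real" where
  "expected_detection_time D lam i x =
     (let c = cycle_length D x
      in 1 / lam i + (c - x $ i) / c *
           (1 / lam i - (c - x $ i) / 2 + (c - x $ i) / (1 - exp (- lam i * x $ i))))"

definition max_detection_time :: "real \<Rightarrow> ('n \<Rightarrow> real) \<Rightarrow> real ^ 'n \<Rightarrow> real" where
  "max_detection_time D lam x = (MAX i. expected_detection_time D lam i x)"

end

theory Submission
  imports Defs
begin

text \<open>
  At a fixed cycle length \<open>c\<close>, the expected detection time at a location depends only on its own
  search time \<open>s\<close> and is strictly decreasing in \<open>s \<in> (0, c)\<close>
  (\<open>expected_detection_time_strict_antimono\<close>). Hence the maximum over the locations is attained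
  where the search time is smallest. Replacing all search times by their mean keeps \<open>c\<close> fixed and,
  unless they all coincide already, strictly raises the smallest one; the maximum then
  drops strictly, so a cycle with unequal search times is never optimal.
\<close>

text \<open>
  The detection time has the form \<open>1 / l + p * (1 / l + q)\<close>, where
  \<open>p = (c - s) / c\<close> and \<open>q = (c - s) * (1 / (1 - exp (- l * s)) - 1 / 2)\<close>. The last factor of
  \<open>q\<close> decreases in \<open>s\<close> and stays above \<open>1 / 2\<close>, so everything is a product of positive decreasing
  functions of \<open>s\<close>.
\<close>

lemma expected_detection_time_strict_antimono:
  fixes x y :: "real ^ 'n"
  assumes l: "0 < l" "lam i = l" "lam j = l"
    and same_length: "cycle_length D x = cycle_length D y"
    and pos: "0 < x $ i" and less: "x $ i < y $ j" and bound: "y $ j < cycle_length D y"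
  shows "expected_detection_time D lam j y < expected_detection_time D lam i x"
proof -
  define c where "c = cycle_length D y"
  define h where "h t = 1 / (1 - exp (- l * t)) - 1 / 2" for t
  define q where "q t = (c - t) * h t" for t
  have form: "expected_detection_time D lam k z = 1 / l + (c - z $ k) / c * (1 / l + q (z $ k))"
    if "lam k = l" "cycle_length D z = c" for k and z :: "real ^ 'n"
    using that by (simp add: expected_detection_time_def q_def h_def algebra_simps)
  have exp_less: "exp (- l * y $ j) < exp (- l * x $ i)"
    using l less by simp
  have exp_less_1: "exp (- l * x $ i) < 1"
    using l pos by simp
  have h_less: "h (y $ j) < h (x $ i)"
    unfolding h_def using exp_less exp_less_1 by (simp add: frac_less2)
  have "1 < 1 / (1 - exp (- l * y $ j))"
    using exp_less exp_less_1 by (simp add: field_simps)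
  then have h_pos: "0 < h (y $ j)"
    unfolding h_def by linarith
  have c_pos: "0 < c" and gap: "0 < c - y $ j" "c - y $ j < c - x $ i"
    using pos less bound by (auto simp: c_def)
  have q_less: "q (y $ j) < q (x $ i)"
    unfolding q_def using h_less h_pos gap by (intro mult_strict_mono) auto
  have q_pos: "0 < q (y $ j)"
    unfolding q_def using h_pos gap by simp
  have "(c - y $ j) / c * (1 / l + q (y $ j)) < (c - x $ i) / c * (1 / l + q (x $ i))"
  proof (rule mult_strict_mono)
    show "(c - y $ j) / c < (c - x $ i) / c"
      using c_pos gap by (simp add: divide_strict_right_mono)
    show "0 < (c - x $ i) / c"
      using c_pos gap by simp
    show "1 / l + q (y $ j) < 1 / l + q (x $ i)" "0 \<le> 1 / l + q (y $ j)"
      using q_less q_pos l by auto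
  qed
  then show ?thesis
    using form[OF l(3)] form[OF l(2)] same_length by (simp add: c_def)
qed

theorem mainTheorem5:
  fixes D l :: real and lam :: "'n::finite \<Rightarrow> real" and x :: "real ^ 'n"
  assumes "CARD('n) \<ge> 2"
    and "0 < D"
    and "0 < l"
    and "\<And>i. lam i = l"
    and "is_arg_min (max_detection_time D lam) (\<lambda>y. y \<in> simple_cycles) x"
  shows "\<forall>i j. x $ i = x $ j"
proof (rule ccontr)
  assume unequal: "\<not> (\<forall>i j. x $ i = x $ j)"
  define m where "m = (\<Sum>j\<in>UNIV. x $ j) / CARD('n)"
  define y :: "real ^ 'n" where "y = (\<chi> j. m)"
  have x_pos: "0 < x $ i" for i
    using assms(5) by (simp add: is_arg_min_def simple_cycles_def)
  have card_m: "CARD('n) * m = (\<Sum>j\<in>UNIV. x $ j)"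
    by (simp add: m_def)
  have "0 < (\<Sum>j\<in>UNIV. x $ j)"
    using x_pos by (intro sum_pos) auto
  then have m_pos: "0 < m"
    by (simp add: m_def)
  have same_length: "cycle_length D x = cycle_length D y"
    using card_m by (simp add: cycle_length_def y_def)
  have "1 * m \<le> CARD('n) * m"
    using m_pos assms(1) by (intro mult_right_mono) auto
  then have m_bound: "m < cycle_length D y"
    using \<open>0 < D\<close> by (simp add: cycle_length_def y_def)
  obtain k where k: "x $ k < m"
  proof (rule ccontr)
    assume "\<not> thesis"
    then have ge: "m \<le> x $ i" for i
      using that by (meson not_le)
    have "(\<Sum>j\<in>UNIV. x $ j - m) = 0"
      using card_m by (simp add: sum_subtractf)
    then have "x $ i - m = 0" for i
      using ge by (subst (asm) sum_nonneg_eq_0_iff) auto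
    then show False
      using unequal by auto
  qed
  have "expected_detection_time D lam j y < max_detection_time D lam x" for j
  proof -
    have "expected_detection_time D lam j y < expected_detection_time D lam k x"
      using assms(3,4) same_length x_pos k m_bound
      by (intro expected_detection_time_strict_antimono) (auto simp: y_def)
    also have "\<dots> \<le> max_detection_time D lam x"
      unfolding max_detection_time_def by (intro Max_ge) auto
    finally show ?thesis .
  qed
  then have "max_detection_time D lam y < max_detection_time D lam x"
    unfolding max_detection_time_def[of D lam y] by (subst Max_less_iff) auto
  moreover have "y \<in> simple_cycles"
    using m_pos by (simp add: simple_cycles_def y_def)
  ultimately show False
    using assms(5) by (auto simp: is_arg_min_def)
qed

end
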